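(* Let $Q$ be a finite quiver, $M$ a finite-dimensional complex representation of $Q$, $r\geq 1$, and let $(M^0,\dots,M^r)$ be a sequence with $M^0=i_0(M)\in\operatorname{Mod}\mathrm{Idem}(Q)$, $M^i\in\operatorname{Mod}\mathrm{Idem}(\Gamma(M^{i-1}))$ and $R(M^i)=\gamma(M^{i-1})$ for each $1\le i\le r$. Let $B$ be a basis of $M$ and $\partial_0,\dots,\partial_r:B\to\mathbb{Z}$ the associated gradings, as defined in the context. Then $(M^0,\dots,M^r)$ is a sequence of equivariant lifts if and only if $\partial_i$ is a nice $(\partial_0,\dots,\partial_{i-1})$-grading on $M$ for all $0\le i\le r$.
   Context: All representations are finite-dimensional over $\mathbb{C}$. For a finite quiver $Q=(Q_0,Q_1,s,t)$, an object $N$ of $\operatorname{Mod}\mathrm{Idem}(Q)$ is a representation $R(N)=((N_x),(N_a))$ of $Q$ together with linear maps $n_i^x:N_x\to N_x$ ($x\in Q_0$, $i\in\mathbb{Z}$), for each $x$ only finitely many non-zero, with $n_i^xn_k^x=0$ for $i\neq k$ and $\sum_i n_i^x=\mathrm{Id}_{N_x}$. For $T\in\mathbb{Z}^{Q_1}$, $\operatorname{Mod}\mathrm{Idem}^T(Q)$ is the full subcategory of those $N$ with $n_i^{t(a)}N_an_k^{s(a)}=0$ whenever $a\in Q_1$ and $i-k\ne T_a$. $i_0(M)\in\operatorname{Mod}\mathrm{Idem}(Q)$ is $M$ with $\mathrm{Id}_{M_x}$ as the idempotent of index $0$ and all other idempotents zero. For $N\in\operatorname{Mod}\mathrm{Idem}(Q)$: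 $\Gamma(N)$ is the quiver whose vertices are the pairs $(x,i)$ with $n_i^x\neq0$, with one arrow $(x,i)\to(y,j)$ for each arrow $a:x\to y$ of $Q$ with $n_j^yN_an_i^x\ne0$. $\gamma(N)$ is the representation of $\Gamma(N)$ with space $\mathrm{Im}(n_i^x)$ at $(x,i)$ and, on the arrow given by $n_j^yN_an_i^x\neq 0$, the map $\mathrm{Im}(n_i^x)\to\mathrm{Im}(n_j^y)$ induced by $n_j^yN_an_i^x$. A sequence $(M^0,\dots,M^r)$ as in the claim is a sequence of equivariant lifts if for every $1\le j\le r$ there is $T_j\in\mathbb{Z}^{\Gamma(M^{j-1})_1}$ with $M^j\in\operatorname{Mod}\mathrm{Idem}^{T_j}(\Gamma(M^{j-1}))$. Basis and gradings: since $R(M^i)=\gamma(M^{i-1})$, each $M_x$ is the direct sum of the images of the non-zero idempotents of $M^r$ lying over $x$, and these decompositions refine those given by $M^{r-1},\dots,M^0$. Choose a basis of each $M_x$ consisting of vectors each lying in the image of an idempotent of $M^r$, and let $B=\bigcup_xB_x$ be the resulting basis of $M$. Each $b\in B$ lies, for every $i$, in the image of exactly one non-zero idempotent of $M^i$; $\partial_i(b)\in\mathbb{Z}$ is the index (weight) of that idempotent. Nice gradings: given gradings $\partial_0,\dots,\partial_{i-1}:B\to\mathbb{Z}$, a map $\partial_i:B\to\mathbb{Z}$ is a nice $(\partial_0,\dots,\partial_{i-1})$-grading on $M$ if there is a function $\Delta:\mathbb{Z}^i\times\mathbb{Z}^i\times Q_1\to\mathbb{Z}$ such that for every arrow $a\in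 Q_1$ and all $e_t\in B_{s(a)}$, $e_j\in B_{t(a)}$ such that $e_j$ has non-zero coefficient in the expansion of $M_a(e_t)$ in the basis $B_{t(a)}$, one has $\Delta\big((\partial_l(e_t))_{0\le l\le i-1},(\partial_l(e_j))_{0\le l\le i-1},a\big)=\partial_i(e_t)-\partial_i(e_j)$. (For $i=0$, $\mathbb{Z}^0$ is a point.) *)

theory Defs
  imports Complex_Main "Graph_Theory.Digraph"
begin

text \<open>
  Quivers are \<open>pre_digraph\<close>s, with \<^term>\<open>tail Q a\<close> the source and \<^term>\<open>head Q a\<close> the target
  of the arrow \<open>a\<close>; finite quivers are \<open>fin_digraph\<close>s (loops and parallel arrows are allowed).

  The spaces of a representation are finite-dimensional subspaces of one ambient complex vector
  space \<open>'w\<close> (with scalar multiplication \<open>scale\<close>).  Spaces at different vertices may overlap, so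
  a vector of the representation is always considered together with its vertex.  Linear maps are
  functions on \<open>'w\<close> of which only the values on the domain subspace are meaningful.
\<close>

record ('v, 'a, 'w) quiver_rep =
  space_at :: "'v \<Rightarrow> 'w set"
  map_at :: "'a \<Rightarrow> 'w \<Rightarrow> 'w"

text \<open>\<open>idem N x i\<close> is the map $n_i^x$.\<close>
record ('v, 'a, 'w) idem_rep = "('v, 'a, 'w) quiver_rep" +
  idem :: "'v \<Rightarrow> int \<Rightarrow> 'w \<Rightarrow> 'w"

text \<open>The representation $R(N)$ underlying an object $N$ of Mod Idem.\<close>
definition underlying :: "('v, 'a, 'w) idem_rep \<Rightarrow> ('v, 'a, 'w) quiver_rep" where
  "underlying N = quiver_rep.truncate N"

definition linear_between ::
    "(complex \<Rightarrow> 'w::ab_group_add \<Rightarrow> 'w) \<Rightarrow> 'w set \<Rightarrow> 'w set \<Rightarrow> ('w \<Rightarrow> 'w) \<Rightarrow> bool" where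
  "linear_between scale V W f \<longleftrightarrow>
     (\<forall>v\<in>V. f v \<in> W) \<and>
     (\<forall>u\<in>V. \<forall>v\<in>V. f (u + v) = f u + f v) \<and>
     (\<forall>c. \<forall>v\<in>V. f (scale c v) = scale c (f v))"

definition is_quiver_rep ::
    "(complex \<Rightarrow> 'w::ab_group_add \<Rightarrow> 'w) \<Rightarrow> ('v, 'a) pre_digraph \<Rightarrow>
     ('v, 'a, 'w) quiver_rep \<Rightarrow> bool" where
  "is_quiver_rep scale Q M \<longleftrightarrow>
     (\<forall>x\<in>verts Q. module.subspace scale (space_at M x) \<and>
        (\<exists>S. finite S \<and> module.span scale S = space_at M x)) \<and>
     (\<forall>a\<in>arcs Q.
        linear_between scale (space_at M (tail Q a)) (space_at M (head Q a)) (map_at M a))"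

text \<open>Equality of representations of \<open>Q\<close>, disregarding the irrelevant values.\<close>
definition rep_eq ::
    "('v, 'a) pre_digraph \<Rightarrow> ('v, 'a, 'w) quiver_rep \<Rightarrow> ('v, 'a, 'w) quiver_rep \<Rightarrow> bool" where
  "rep_eq Q M M' \<longleftrightarrow>
     (\<forall>x\<in>verts Q. space_at M x = space_at M' x) \<and>
     (\<forall>a\<in>arcs Q. \<forall>v\<in>space_at M (tail Q a). map_at M a v = map_at M' a v)"

text \<open>The indices \<open>i\<close> with $n_i^x \neq 0$.\<close>
definition weights :: "('v, 'a, 'w::zero) idem_rep \<Rightarrow> 'v \<Rightarrow> int set" where
  "weights N x = {i. \<exists>v\<in>space_at N x. idem N x i v \<noteq> 0}"

definition mod_idem ::
    "(complex \<Rightarrow> 'w::ab_group_add \<Rightarrow> 'w) \<Rightarrow> ('v, 'a) pre_digraph \<Rightarrow>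
     ('v, 'a, 'w) idem_rep \<Rightarrow> bool" where
  "mod_idem scale Q N \<longleftrightarrow>
     is_quiver_rep scale Q (underlying N) \<and>
     (\<forall>x\<in>verts Q.
        (\<forall>i. linear_between scale (space_at N x) (space_at N x) (idem N x i)) \<and>
        finite (weights N x) \<and>
        (\<forall>i k. i \<noteq> k \<longrightarrow> (\<forall>v\<in>space_at N x. idem N x i (idem N x k v) = 0)) \<and>
        (\<forall>v\<in>space_at N x. (\<Sum>i\<in>weights N x. idem N x i v) = v))"

definition mod_idem_shift ::
    "(complex \<Rightarrow> 'w::ab_group_add \<Rightarrow> 'w) \<Rightarrow> ('v, 'a) pre_digraph \<Rightarrow> ('a \<Rightarrow> int) \<Rightarrow>
     ('v, 'a, 'w) idem_rep \<Rightarrow> bool" where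
  "mod_idem_shift scale Q T N \<longleftrightarrow>
     mod_idem scale Q N \<and>
     (\<forall>a\<in>arcs Q. \<forall>i k. i - k \<noteq> T a \<longrightarrow>
        (\<forall>v\<in>space_at N (tail Q a).
           idem N (head Q a) i (map_at N a (idem N (tail Q a) k v)) = 0))"

text \<open>The object $i_0(M)$.\<close>
definition idem0 :: "('v, 'a, 'w::zero) quiver_rep \<Rightarrow> ('v, 'a, 'w) idem_rep" where
  "idem0 M = \<lparr>space_at = space_at M, map_at = map_at M,
              idem = (\<lambda>x i v. if i = 0 then v else 0)\<rparr>"

text \<open>
  The vertices of the iterated quivers $\Gamma(M^i)$ are nested pairs.  The following two types
  contain them for all \<open>i\<close>: \<open>Lift_vertex x i\<close> is the vertex $(x,i)$ of $\Gamma(N)$, and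
  \<open>Lift_arrow a i j\<close> is the arrow of $\Gamma(N)$ given by $n_j^{t(a)} N_a n_i^{s(a)} \neq 0$.
\<close>
datatype 'v vertex = Base_vertex 'v | Lift_vertex "'v vertex" int
datatype 'a arrow = Base_arrow 'a | Lift_arrow "'a arrow" int int

definition base_quiver :: "('v, 'a) pre_digraph \<Rightarrow> ('v vertex, 'a arrow) pre_digraph" where
  "base_quiver Q = \<lparr>verts = Base_vertex ` verts Q, arcs = Base_arrow ` arcs Q,
     tail = (\<lambda>e. case e of Base_arrow a \<Rightarrow> Base_vertex (tail Q a) | Lift_arrow _ _ _ \<Rightarrow> undefined),
     head = (\<lambda>e. case e of Base_arrow a \<Rightarrow> Base_vertex (head Q a) | Lift_arrow _ _ _ \<Rightarrow> undefined)\<rparr>"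

definition base_rep :: "('v, 'a, 'w) quiver_rep \<Rightarrow> ('v vertex, 'a arrow, 'w) quiver_rep" where
  "base_rep M = \<lparr>
     space_at = (\<lambda>X. case X of Base_vertex x \<Rightarrow> space_at M x | Lift_vertex _ _ \<Rightarrow> undefined),
     map_at = (\<lambda>e. case e of Base_arrow a \<Rightarrow> map_at M a | Lift_arrow _ _ _ \<Rightarrow> undefined)\<rparr>"

text \<open>The vertex of the original quiver over which an iterated vertex lies.\<close>
primrec base_of :: "'v vertex \<Rightarrow> 'v" where
  "base_of (Base_vertex x) = x"
| "base_of (Lift_vertex X i) = base_of X"

definition Gamma_quiver ::
    "('v vertex, 'a arrow) pre_digraph \<Rightarrow> ('v vertex, 'a arrow, 'w::zero) idem_rep \<Rightarrow>
     ('v vertex, 'a arrow) pre_digraph" where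
  "Gamma_quiver Q N = \<lparr>
     verts = {Lift_vertex x i | x i. x \<in> verts Q \<and> i \<in> weights N x},
     arcs = {Lift_arrow a i j | a i j. a \<in> arcs Q \<and>
        (\<exists>v\<in>space_at N (tail Q a).
           idem N (head Q a) j (map_at N a (idem N (tail Q a) i v)) \<noteq> 0)},
     tail = (\<lambda>e. case e of Base_arrow _ \<Rightarrow> undefined
                         | Lift_arrow a i j \<Rightarrow> Lift_vertex (tail Q a) i),
     head = (\<lambda>e. case e of Base_arrow _ \<Rightarrow> undefined
                         | Lift_arrow a i j \<Rightarrow> Lift_vertex (head Q a) j)\<rparr>"

definition gamma_rep ::
    "('v vertex, 'a arrow) pre_digraph \<Rightarrow> ('v vertex, 'a arrow, 'w) idem_rep \<Rightarrow>
     ('v vertex, 'a arrow, 'w) quiver_rep" where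
  "gamma_rep Q N = \<lparr>
     space_at = (\<lambda>X. case X of Base_vertex _ \<Rightarrow> undefined
                             | Lift_vertex x i \<Rightarrow> idem N x i ` space_at N x),
     map_at = (\<lambda>e v. case e of Base_arrow _ \<Rightarrow> undefined
                | Lift_arrow a i j \<Rightarrow>
                    idem N (head Q a) j (map_at N a (idem N (tail Q a) i v)))\<rparr>"

text \<open>
  For a sequence \<open>Ms\<close> $= (M^0, M^1, \dots)$, \<open>tower Q Ms i\<close> is the quiver of which $M^i$ is a
  representation, namely \<open>Q\<close> for \<open>i = 0\<close> and $\Gamma(M^{i-1})$ for \<open>i > 0\<close>.
\<close>
primrec tower ::
    "('v, 'a) pre_digraph \<Rightarrow> (nat \<Rightarrow> ('v vertex, 'a arrow, 'w::zero) idem_rep) \<Rightarrow> nat \<Rightarrow>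
     ('v vertex, 'a arrow) pre_digraph" where
  "tower Q Ms 0 = base_quiver Q"
| "tower Q Ms (Suc i) = Gamma_quiver (tower Q Ms i) (Ms i)"

definition lift_sequence ::
    "(complex \<Rightarrow> 'w::ab_group_add \<Rightarrow> 'w) \<Rightarrow> ('v, 'a) pre_digraph \<Rightarrow> ('v, 'a, 'w) quiver_rep \<Rightarrow>
     nat \<Rightarrow> (nat \<Rightarrow> ('v vertex, 'a arrow, 'w) idem_rep) \<Rightarrow> bool" where
  "lift_sequence scale Q M r Ms \<longleftrightarrow>
     Ms 0 = idem0 (base_rep M) \<and>
     (\<forall>i\<in>{1..r}. mod_idem scale (tower Q Ms i) (Ms i) \<and>
        rep_eq (tower Q Ms i) (underlying (Ms i)) (gamma_rep (tower Q Ms (i - 1)) (Ms (i - 1))))"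

definition equivariant_lifts ::
    "(complex \<Rightarrow> 'w::ab_group_add \<Rightarrow> 'w) \<Rightarrow> ('v, 'a) pre_digraph \<Rightarrow> nat \<Rightarrow>
     (nat \<Rightarrow> ('v vertex, 'a arrow, 'w) idem_rep) \<Rightarrow> bool" where
  "equivariant_lifts scale Q r Ms \<longleftrightarrow>
     (\<forall>j\<in>{1..r}. \<exists>T. mod_idem_shift scale (tower Q Ms j) T (Ms j))"

text \<open>
  The vector \<open>b\<close> at the vertex \<open>x\<close> of \<open>Q\<close> lies in the image of the non-zero idempotent of $M^i$
  that has index \<open>k\<close> and is attached to the vertex \<open>X\<close> over \<open>x\<close>.
\<close>
definition lies_in ::
    "('v, 'a) pre_digraph \<Rightarrow> (nat \<Rightarrow> ('v vertex, 'a arrow, 'w::zero) idem_rep) \<Rightarrow> nat \<Rightarrow>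
     'v \<times> 'w \<Rightarrow> 'v vertex \<Rightarrow> int \<Rightarrow> bool" where
  "lies_in Q Ms i = (\<lambda>(x, b) X k.
     X \<in> verts (tower Q Ms i) \<and> base_of X = x \<and> k \<in> weights (Ms i) X \<and>
     b \<in> idem (Ms i) X k ` space_at (Ms i) X)"

text \<open>A basis is a family \<open>B\<close> of bases of the spaces $M_x$.\<close>
definition rep_basis ::
    "(complex \<Rightarrow> 'w::ab_group_add \<Rightarrow> 'w) \<Rightarrow> ('v, 'a) pre_digraph \<Rightarrow> ('v, 'a, 'w) quiver_rep \<Rightarrow>
     ('v \<Rightarrow> 'w set) \<Rightarrow> bool" where
  "rep_basis scale Q M B \<longleftrightarrow>
     (\<forall>x\<in>verts Q. \<not> module.dependent scale (B x) \<and> module.span scale (B x) = space_at M x)"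

definition adapted_basis ::
    "(complex \<Rightarrow> 'w::ab_group_add \<Rightarrow> 'w) \<Rightarrow> ('v, 'a) pre_digraph \<Rightarrow> ('v, 'a, 'w) quiver_rep \<Rightarrow>
     nat \<Rightarrow> (nat \<Rightarrow> ('v vertex, 'a arrow, 'w) idem_rep) \<Rightarrow> ('v \<Rightarrow> 'w set) \<Rightarrow> bool" where
  "adapted_basis scale Q M r Ms B \<longleftrightarrow>
     rep_basis scale Q M B \<and>
     (\<forall>x\<in>verts Q. \<forall>b\<in>B x. \<exists>X k. lies_in Q Ms r (x, b) X k)"

text \<open>
  The grading $\partial_i$.  For an element \<open>(x, b)\<close> of an adapted basis there is exactly one pair
  \<open>(X, k)\<close> with \<open>lies_in Q Ms i (x, b) X k\<close>.
\<close>
definition lift_grading ::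
    "('v, 'a) pre_digraph \<Rightarrow> (nat \<Rightarrow> ('v vertex, 'a arrow, 'w::zero) idem_rep) \<Rightarrow> nat \<Rightarrow>
     'v \<times> 'w \<Rightarrow> int" where
  "lift_grading Q Ms i e = snd (THE (X, k). lies_in Q Ms i e X k)"

text \<open>
  \<open>nice_grading scale Q M B ds d\<close>: the grading \<open>d\<close> is a nice \<open>ds\<close>-grading, for the list \<open>ds\<close> of
  the previously given gradings.  Elements of $\mathbb{Z}^i$ are lists of length \<open>i = length ds\<close>.
\<close>
definition nice_grading ::
    "(complex \<Rightarrow> 'w::ab_group_add \<Rightarrow> 'w) \<Rightarrow> ('v, 'a) pre_digraph \<Rightarrow> ('v, 'a, 'w) quiver_rep \<Rightarrow>
     ('v \<Rightarrow> 'w set) \<Rightarrow> ('v \<times> 'w \<Rightarrow> int) list \<Rightarrow> ('v \<times> 'w \<Rightarrow> int) \<Rightarrow> bool" where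
  "nice_grading scale Q M B ds d \<longleftrightarrow>
     (\<exists>\<Delta> :: int list \<Rightarrow> int list \<Rightarrow> 'a \<Rightarrow> int.
        \<forall>a\<in>arcs Q. \<forall>u\<in>B (tail Q a). \<forall>w\<in>B (head Q a).
          module.representation scale (B (head Q a)) (map_at M a u) w \<noteq> 0 \<longrightarrow>
          \<Delta> (map (\<lambda>f. f (tail Q a, u)) ds) (map (\<lambda>f. f (head Q a, w)) ds) a
            = d (tail Q a, u) - d (head Q a, w))"

end

theory Submission
  imports Defs
begin

text \<open>
  The theorem is proved one level at a time: \<open>M\<^sup>i\<close> is homogeneous for some shift \<open>T\<close> if and only
  if \<open>\<partial>\<^sub>i\<close> is nice for \<open>\<partial>\<^sub>0, \<dots>, \<partial>\<^sub>i\<^sub>-\<^sub>1\<close>.  The two conditions say the same thing about the matrices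
  of the maps \<open>M\<^sub>a\<close> in the basis \<open>B\<close>, for three reasons.

  At level \<open>i\<close> every basis vector lies in the image of exactly one idempotent.  Its vertex in
  the quiver of level \<open>i\<close> is spelled out by its first \<open>i\<close> gradings, and \<open>\<partial>\<^sub>i\<close> is its index there
  (\<open>vertex_weights_sits\<close>, \<open>lift_grading_sits\<close>).

  The vectors of \<open>B\<close> that belong to the space at a vertex form a basis of that space, and the
  idempotents there fix or kill each of them.  So an idempotent is a coordinate projection
  (\<open>coord_idem\<close>), and by induction on the level the map of an arrow of the tower over \<open>a\<close> is the
  block of the matrix of \<open>M\<^sub>a\<close> whose columns and rows belong to its two ends (\<open>coord_arrow\<close>).

  At every level, a non-zero entry of \<open>M\<^sub>a\<close> in column \<open>e\<^sub>t\<close> and row \<open>e\<^sub>j\<close> lies in the block between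
  the vertices of \<open>e\<^sub>t\<close> and \<open>e\<^sub>j\<close>; this block is non-zero, so there is an arrow of the tower for it
  (\<open>arrow_of_entry\<close>).  Conversely, a
  non-zero composite \<open>n\<^sub>l N\<^sub>A n\<^sub>k\<close> has a non-zero entry (\<open>nonzero_entry\<close>).

  Hence the shift condition for an arrow \<open>A\<close> says that \<open>\<partial>\<^sub>i(e\<^sub>j) - \<partial>\<^sub>i(e\<^sub>t) = T\<^sub>A\<close> for all non-zero
  entries in the block of \<open>A\<close>.  Since \<open>A\<close> is determined by \<open>a\<close> and the weights along its two ends
  (\<open>arrow_unique\<close>), the functions \<open>T\<close> and \<open>-\<Delta>\<close> carry the same information.
\<close>

section \<open>Decompositions given by orthogonal idempotents\<close>

locale complex_vector_space = vector_space scale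
  for scale :: "complex \<Rightarrow> 'w::ab_group_add \<Rightarrow> 'w"
begin

lemma linear_between_zero:
  assumes "linear_between scale V W f" and "subspace V"
  shows "f 0 = 0"
proof -
  have "f (0 + 0) = f 0 + f 0"
    using assms subspace_0 unfolding linear_between_def by blast
  then show ?thesis by simp
qed

lemma mod_idem_space:
  assumes "mod_idem scale R N" and "X \<in> verts R"
  shows "subspace (space_at N X)"
  using assms
  by (auto simp: mod_idem_def is_quiver_rep_def underlying_def quiver_rep.truncate_def)

lemma mod_idem_linear:
  assumes "mod_idem scale R N" and "X \<in> verts R"
  shows "linear_between scale (space_at N X) (space_at N X) (idem N X k)"
  using assms by (auto simp: mod_idem_def)

lemma mod_idem_arrow_linear:
  assumes "mod_idem scale R N" and "A \<in> arcs R"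
  shows "linear_between scale (space_at N (tail R A)) (space_at N (head R A)) (map_at N A)"
  using assms
  by (auto simp: mod_idem_def is_quiver_rep_def underlying_def quiver_rep.truncate_def)

lemma idem_image_subset:
  assumes "mod_idem scale R N" and "X \<in> verts R"
  shows "idem N X k ` space_at N X \<subseteq> space_at N X"
  using mod_idem_linear[OF assms, of k] by (auto simp: linear_between_def)

lemma idem_kills_other_image:
  assumes "mod_idem scale R N" and "X \<in> verts R"
    and "v \<in> idem N X k ` space_at N X" and "i \<noteq> k"
  shows "idem N X i v = 0"
  using assms by (auto simp: mod_idem_def)

text \<open>Idempotency is not part of the data: it follows by applying the map of index \<open>k\<close> to
  the decomposition of the identity.\<close>

lemma idem_fixes_image:
  assumes N: "mod_idem scale R N" "X \<in> verts R" and v: "v \<in> idem N X k ` space_at N X"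
  shows "idem N X k v = v"
proof -
  have vX: "v \<in> space_at N X" using idem_image_subset[OF N] v by blast
  have fin: "finite (weights N X)" and "(\<Sum>i\<in>weights N X. idem N X i v) = v"
    using N vX by (auto simp: mod_idem_def)
  moreover have "(\<Sum>i\<in>weights N X. idem N X i v)
      = (\<Sum>i\<in>weights N X. if i = k then idem N X k v else 0)"
    by (rule sum.cong) (use idem_kills_other_image[OF N v] in auto)
  ultimately have "v = (if k \<in> weights N X then idem N X k v else 0)"
    by (simp add: sum.delta)
  moreover have "idem N X k v = 0" if "k \<notin> weights N X"
    using that vX by (auto simp: weights_def)
  ultimately show ?thesis by (auto split: if_splits)
qed

end

section \<open>The tower of an adapted basis\<close>

primrec base_arrow_of :: "'a arrow \<Rightarrow> 'a" where
  "base_arrow_of (Base_arrow a) = a"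
| "base_arrow_of (Lift_arrow A i j) = base_arrow_of A"

primrec vertex_weights :: "'v vertex \<Rightarrow> int list" where
  "vertex_weights (Base_vertex x) = []"
| "vertex_weights (Lift_vertex X i) = vertex_weights X @ [i]"

locale adapted_lifts = complex_vector_space scale
  for scale :: "complex \<Rightarrow> 'w::ab_group_add \<Rightarrow> 'w" +
  fixes Q :: "('v, 'a) pre_digraph"
    and M :: "('v, 'a, 'w) quiver_rep"
    and r :: nat
    and Ms :: "nat \<Rightarrow> ('v vertex, 'a arrow, 'w) idem_rep"
    and B :: "'v \<Rightarrow> 'w set"
  assumes wf_Q: "wf_digraph Q"
    and rep_M: "is_quiver_rep scale Q M"
    and lifts: "lift_sequence scale Q M r Ms"
    and adapted: "adapted_basis scale Q M r Ms B"
begin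

abbreviation quiver :: "nat \<Rightarrow> ('v vertex, 'a arrow) pre_digraph" where
  "quiver \<equiv> tower Q Ms"

abbreviation part :: "nat \<Rightarrow> 'v vertex \<Rightarrow> 'w set" where
  "part i X \<equiv> space_at (Ms i) X"

text \<open>The pair \<open>(X, k)\<close> with \<open>sits i (x, b) X k\<close> is called the position of \<open>b\<close> at level \<open>i\<close>.\<close>

abbreviation sits :: "nat \<Rightarrow> 'v \<times> 'w \<Rightarrow> 'v vertex \<Rightarrow> int \<Rightarrow> bool" where
  "sits \<equiv> lies_in Q Ms"

abbreviation coord :: "'v \<Rightarrow> 'w \<Rightarrow> 'w \<Rightarrow> complex" where
  "coord x \<equiv> representation (B x)"

(* The successor level is accessed through verts_Suc, arcs_Suc and ends_Suc, so that the
   recursion equation must not unfold it first. *)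
declare tower.simps(2) [simp del]

lemma Ms_0: "Ms 0 = idem0 (base_rep M)"
  using lifts by (simp add: lift_sequence_def)

lemma basis:
  assumes "x \<in> verts Q"
  shows "independent (B x)" and "span (B x) = space_at M x"
  using assms adapted by (auto simp: adapted_basis_def rep_basis_def)

lemma basis_nonzero: "x \<in> verts Q \<Longrightarrow> b \<in> B x \<Longrightarrow> b \<noteq> 0"
  using basis(1) dependent_zero by blast

lemma arcs_Q:
  assumes "a \<in> arcs Q"
  shows "tail Q a \<in> verts Q" and "head Q a \<in> verts Q"
  using assms wf_Q by (auto simp: wf_digraph_def)

lemma verts_0: "X \<in> verts (quiver 0) \<longleftrightarrow> (\<exists>x\<in>verts Q. X = Base_vertex x)"
  by (auto simp: base_quiver_def)

lemma verts_Suc: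
  "X \<in> verts (quiver (Suc i)) \<longleftrightarrow>
     (\<exists>Y k. X = Lift_vertex Y k \<and> Y \<in> verts (quiver i) \<and> k \<in> weights (Ms i) Y)"
  by (auto simp: Gamma_quiver_def tower.simps(2))

lemma part_0: "part 0 (Base_vertex x) = space_at M x"
  by (simp add: Ms_0 idem0_def base_rep_def)

lemma idem_0: "idem (Ms 0) X k v = (if k = 0 then v else 0)"
  by (simp add: Ms_0 idem0_def)

text \<open>The equality \<open>R(M\<^sup>i) = \<gamma>(M\<^sup>i\<^sup>-\<^sup>1)\<close> is only demanded at vertices and arrows of the
  tower, hence the membership hypothesis here and in \<open>map_Suc\<close>.\<close>

lemma part_Suc:
  assumes "Suc i \<le> r" and "Lift_vertex Y k \<in> verts (quiver (Suc i))"
  shows "part (Suc i) (Lift_vertex Y k) = idem (Ms i) Y k ` part i Y"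
proof -
  have "rep_eq (quiver (Suc i)) (underlying (Ms (Suc i))) (gamma_rep (quiver i) (Ms i))"
    using lifts assms(1) unfolding lift_sequence_def by force
  then show ?thesis using assms(2)
    by (auto simp: rep_eq_def underlying_def quiver_rep.truncate_def gamma_rep_def)
qed

text \<open>At a vertex with zero space the index \<open>0\<close> is not a weight of \<open>M\<^sup>0\<close>, and the sum over the
  weights is empty.\<close>

lemma mod_idem_0: "mod_idem scale (quiver 0) (Ms 0)"
proof -
  have fin: "weights (Ms 0) X \<subseteq> {0}" for X
    by (auto simp: weights_def idem_0 split: if_splits)
  have rep: "is_quiver_rep scale (quiver 0) (underlying (Ms 0))"
    using rep_M by (auto simp: is_quiver_rep_def underlying_def quiver_rep.truncate_def Ms_0
        idem0_def base_rep_def base_quiver_def)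
  have sub: "subspace (part 0 X)" if "X \<in> verts (quiver 0)" for X
    using rep that by (auto simp: is_quiver_rep_def underlying_def quiver_rep.truncate_def)
  have "(\<Sum>i\<in>weights (Ms 0) X. idem (Ms 0) X i v) = v" if "v \<in> part 0 X" for X v
  proof (cases "v = 0")
    case True
    then show ?thesis by (simp add: idem_0)
  next
    case False
    have "0 \<in> weights (Ms 0) X"
      unfolding weights_def mem_Collect_eq
      by (rule bexI[OF _ that]) (use False in \<open>simp add: idem_0\<close>)
    then have "weights (Ms 0) X = {0}" using fin[of X] by blast
    then have "(\<Sum>i\<in>weights (Ms 0) X. idem (Ms 0) X i v) = idem (Ms 0) X 0 v"
      by (simp only: sum.insert finite.emptyI empty_iff sum.empty not_False_eq_True add_0_right)
    then show ?thesis by (simp only: idem_0 if_True simp_thms)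
  qed
  moreover have "finite (weights (Ms 0) X)" for X
    using finite_subset[OF fin] by simp
  moreover have "linear_between scale (part 0 X) (part 0 X) (idem (Ms 0) X k)"
    if "X \<in> verts (quiver 0)" for X k
    using subspace_0[OF sub[OF that]] by (simp add: linear_between_def idem_0)
  moreover have "idem (Ms 0) X i (idem (Ms 0) X k v) = 0" if "i \<noteq> k" for X i k v
    using that by (simp add: idem_0)
  ultimately show ?thesis
    using rep unfolding mod_idem_def by blast
qed

lemma mod_idem_level: "i \<le> r \<Longrightarrow> mod_idem scale (quiver i) (Ms i)"
proof (cases "i = 0")
  case True
  then show ?thesis using mod_idem_0 by blast
next
  case False
  moreover assume "i \<le> r"
  ultimately have "i \<in> {1..r}" by simp
  then show ?thesis using lifts unfolding lift_sequence_def by blast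
qed

lemma base_of_verts: "i \<le> r \<Longrightarrow> X \<in> verts (quiver i) \<Longrightarrow> base_of X \<in> verts Q"
proof (induction i arbitrary: X)
  case 0
  then show ?case using verts_0 by auto
next
  case (Suc i)
  then obtain Y k where "X = Lift_vertex Y k" "Y \<in> verts (quiver i)" by (meson verts_Suc)
  then show ?case using Suc by simp
qed

lemma part_subset: "i \<le> r \<Longrightarrow> X \<in> verts (quiver i) \<Longrightarrow> part i X \<subseteq> space_at M (base_of X)"
proof (induction i arbitrary: X)
  case 0
  then show ?case using verts_0 part_0 by auto
next
  case (Suc i)
  then obtain Y k where X: "X = Lift_vertex Y k" and Y: "Y \<in> verts (quiver i)"
    by (meson verts_Suc)
  have "part (Suc i) X \<subseteq> part i Y"
    using part_Suc Suc.prems X idem_image_subset[OF mod_idem_level Y] by force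
  then show ?case using Suc X Y by force
qed

lemma part_span: "i \<le> r \<Longrightarrow> X \<in> verts (quiver i) \<Longrightarrow> part i X \<subseteq> span (B (base_of X))"
  using part_subset[of i X] basis(2)[OF base_of_verts[of i X]] by simp

subsection \<open>Each basis vector has one position at every level\<close>

lemma sitsI:
  assumes "i \<le> r" and "X \<in> verts (quiver i)"
    and "b \<in> idem (Ms i) X k ` part i X" and "b \<noteq> 0"
  shows "sits i (base_of X, b) X k"
proof -
  have "idem (Ms i) X k b = b" and "b \<in> part i X"
    using idem_fixes_image[OF mod_idem_level] idem_image_subset[OF mod_idem_level] assms by blast+
  then have "k \<in> weights (Ms i) X" using assms(4) unfolding weights_def by force
  then show ?thesis using assms by (simp add: lies_in_def)
qed

lemma sitsD:
  assumes "sits i (x, b) X k"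
  shows "X \<in> verts (quiver i)" and "base_of X = x" and "k \<in> weights (Ms i) X"
    and "b \<in> idem (Ms i) X k ` part i X"
  using assms by (auto simp: lies_in_def)

lemma sits_part:
  assumes "i \<le> r" and "sits i (x, b) X k"
  shows "b \<in> part i X"
  using idem_image_subset[OF mod_idem_level[OF assms(1)] sitsD(1)[OF assms(2)]]
    sitsD(4)[OF assms(2)] by blast

lemma sits_idem:
  assumes "i \<le> r" and "sits i (x, b) X k"
  shows "idem (Ms i) X l b = (if l = k then b else 0)"
  using idem_fixes_image[OF mod_idem_level[OF assms(1)] sitsD(1,4)[OF assms(2)]]
    idem_kills_other_image[OF mod_idem_level[OF assms(1)] sitsD(1,4)[OF assms(2)], of l] by simp

lemma sits_Suc_cases:
  assumes "Suc i \<le> r" and "sits (Suc i) (x, b) X k"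
  obtains Y l where "X = Lift_vertex Y l" and "sits i (x, b) Y l"
proof -
  obtain Y l where X: "X = Lift_vertex Y l" and "Y \<in> verts (quiver i)" "l \<in> weights (Ms i) Y"
    using sitsD(1)[OF assms(2)] by (meson verts_Suc)
  moreover have "b \<in> idem (Ms i) Y l ` part i Y"
    using sits_part[OF assms] part_Suc[OF assms(1)] X sitsD(1)[OF assms(2)] by blast
  ultimately have "sits i (x, b) Y l"
    using sitsD(2)[OF assms(2)] by (simp add: lies_in_def)
  with X show thesis by (rule that)
qed

text \<open>The basis is adapted to the top of the tower only; the spaces of each level are images of
  idempotents of the level below, so positions descend.\<close>

lemma sits_exists:
  assumes "i \<le> r" and "x \<in> verts Q" and "b \<in> B x"
  shows "\<exists>X k. sits i (x, b) X k"
  using assms(1)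
proof (induction i rule: inc_induct)
  case base
  show ?case using adapted assms by (auto simp: adapted_basis_def)
next
  case (step i)
  then show ?case by (meson sits_Suc_cases Suc_leI)
qed

text \<open>A non-zero vector cannot belong to the spaces at two vertices \<open>X \<noteq> Y\<close> of one level over the same
  \<open>x\<close>: at the level where they branch off, it would be fixed by two orthogonal idempotents.\<close>

lemma sits_vertex_unique:
  assumes "i \<le> r" and "b \<noteq> 0" and "sits i (x, b) X k"
    and "Y \<in> verts (quiver i)" and "base_of Y = x" and "b \<in> part i Y"
  shows "X = Y"
  using assms(1,3-)
proof (induction i arbitrary: X Y k)
  case 0
  then show ?case using verts_0 sitsD by (metis base_of.simps(1))
next
  case (Suc i)
  from Suc.prems obtain X' k' where X: "X = Lift_vertex X' k'" "sits i (x, b) X' k'"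
    by (meson sits_Suc_cases)
  obtain Y' l' where Y: "Y = Lift_vertex Y' l'" "Y' \<in> verts (quiver i)"
    using Suc.prems by (meson verts_Suc)
  have "b \<in> idem (Ms i) Y' l' ` part i Y'" using part_Suc Suc.prems Y by blast
  then have Y_at: "sits i (x, b) Y' l'"
    using sitsI[of i Y' b l'] Suc.prems Y \<open>b \<noteq> 0\<close> by simp
  have "X' = Y'"
    using Suc.IH[OF _ X(2)] Y Y_at Suc.prems sits_part[of i x b Y' l'] by simp
  moreover have "k' = l'"
    using sits_idem[OF _ X(2), of k'] sits_idem[OF _ Y_at, of k'] \<open>X' = Y'\<close> Suc.prems \<open>b \<noteq> 0\<close>
    by (auto split: if_splits)
  ultimately show ?case using X Y by simp
qed

lemma sits_unique:
  assumes "i \<le> r" and "b \<noteq> 0" and "sits i (x, b) X k" and "sits i (x, b) Y l"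
  shows "X = Y \<and> k = l"
proof -
  have "X = Y"
    by (rule sits_vertex_unique[OF assms(1-3) sitsD(1,2)[OF assms(4)] sits_part[OF assms(1,4)]])
  moreover have "k = l"
    using sits_idem[OF assms(1,3), of k] sits_idem[OF assms(1,4), of k] calculation assms(2)
    by (auto split: if_splits)
  ultimately show ?thesis by blast
qed

lemma sits_of_part:
  assumes "i \<le> r" and "X \<in> verts (quiver i)" and "b \<in> B (base_of X)" and "b \<in> part i X"
  obtains k where "sits i (base_of X, b) X k"
proof -
  have x: "base_of X \<in> verts Q" using base_of_verts assms by blast
  obtain Y k where "sits i (base_of X, b) Y k" using sits_exists[OF assms(1) x assms(3)] by blast
  moreover have "Y = X"
    by (rule sits_vertex_unique[OF assms(1) basis_nonzero[OF x assms(3)] calculation assms(2)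
          refl assms(4)])
  ultimately show thesis using that by blast
qed

lemma lift_grading_sits:
  assumes "i \<le> r" and "b \<noteq> 0" and "sits i (x, b) X k"
  shows "lift_grading Q Ms i (x, b) = k"
proof -
  have "(THE (X, k). sits i (x, b) X k) = (X, k)"
  proof (rule the_equality)
    show "case (X, k) of (X, k) \<Rightarrow> sits i (x, b) X k" using assms(3) by simp
  next
    fix p assume "case p of (X, k) \<Rightarrow> sits i (x, b) X k"
    then have "sits i (x, b) (fst p) (snd p)" by (simp add: case_prod_beta)
    then have "X = fst p \<and> k = snd p" by (rule sits_unique[OF assms])
    then show "p = (X, k)" by simp
  qed
  then show ?thesis by (simp add: lift_grading_def)
qed

text \<open>A vertex of level \<open>i\<close> is built by appending indices, and those of the position of a basis
  vector are its gradings.  So the arguments of \<open>\<Delta>\<close> in a nice grading name the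
  two ends of an arrow of the tower.\<close>

lemma vertex_weights_sits:
  assumes "i \<le> r" and "b \<noteq> 0" and "sits i (x, b) X k"
  shows "map (\<lambda>f. f (x, b)) (map (lift_grading Q Ms) [0..<i]) = vertex_weights X"
  using assms(1,3)
proof (induction i arbitrary: X k)
  case 0
  then show ?case using verts_0 sitsD(1) by fastforce
next
  case (Suc i)
  from Suc.prems obtain Y l where Y: "X = Lift_vertex Y l" "sits i (x, b) Y l"
    by (meson sits_Suc_cases)
  then show ?case
    using Suc.IH[OF _ Y(2)] Suc.prems lift_grading_sits[OF _ assms(2) Y(2)] by simp
qed

section \<open>Idempotents and arrow maps in coordinates\<close>

text \<open>The spanning hypothesis is the conclusion of \<open>part_spanned\<close> at the same level: the two
  alternate in the induction, as the spaces of one level are the images of idempotents of the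
  previous one.  The reason for the step is that an idempotent fixes or kills every basis vector
  of the space on which it acts.\<close>

lemma idem_image_span_step:
  assumes "i \<le> r" and X: "X \<in> verts (quiver i)"
    and span: "part i X \<subseteq> span {b \<in> B (base_of X). b \<in> part i X}"
  shows "idem (Ms i) X k ` part i X \<subseteq> span {b \<in> B (base_of X). sits i (base_of X, b) X k}"
    (is "_ \<subseteq> span ?C")
proof -
  note N = mod_idem_level[OF \<open>i \<le> r\<close>]
  note L = mod_idem_linear[OF N X, of k] and V = mod_idem_space[OF N X]
  have "v \<in> part i X \<and> idem (Ms i) X k v \<in> span ?C"
    if "v \<in> span {b \<in> B (base_of X). b \<in> part i X}" for v
    using that
  proof (rule span_induct)
    show "subspace {v. v \<in> part i X \<and> idem (Ms i) X k v \<in> span ?C}"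
      using L V linear_between_zero[OF L V]
      by (auto intro!: subspaceI simp: linear_between_def subspace_0 subspace_add subspace_scale
          span_zero span_add span_scale)
  next
    fix b assume b: "b \<in> {b \<in> B (base_of X). b \<in> part i X}"
    then obtain l where l: "sits i (base_of X, b) X l" using sits_of_part[OF assms(1,2)] by blast
    show "b \<in> part i X \<and> idem (Ms i) X k b \<in> span ?C"
      using sits_idem[OF assms(1) l, of k] l b by (auto intro: span_base span_zero)
  qed
  then show ?thesis using span by blast
qed

lemma part_spanned:
  "i \<le> r \<Longrightarrow> X \<in> verts (quiver i) \<Longrightarrow> part i X \<subseteq> span {b \<in> B (base_of X). b \<in> part i X}"
proof (induction i arbitrary: X)
  case 0
  then obtain x where x: "X = Base_vertex x" "x \<in> verts Q" using verts_0 by blast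
  then have "{b \<in> B (base_of X). b \<in> part 0 X} = B x"
    using part_0 basis(2)[OF x(2)] span_superset[of "B x"] by auto
  then show ?case using x part_0 basis(2) by simp
next
  case (Suc i)
  then obtain Y k where Y: "X = Lift_vertex Y k" "Y \<in> verts (quiver i)"
    by (meson verts_Suc)
  have im: "part (Suc i) X = idem (Ms i) Y k ` part i Y" using part_Suc Suc.prems Y by blast
  have "part (Suc i) X \<subseteq> span {b \<in> B (base_of Y). sits i (base_of Y, b) Y k}"
    unfolding im using idem_image_span_step[of i Y k] Suc Y by simp
  also have "\<dots> \<subseteq> span {b \<in> B (base_of X). b \<in> part (Suc i) X}"
    by (rule span_mono) (use Y im sitsD(4) in auto)
  finally show ?case .
qed

lemma idem_image_spanned:
  assumes "i \<le> r" and "X \<in> verts (quiver i)"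
  shows "idem (Ms i) X k ` part i X \<subseteq> span {b \<in> B (base_of X). sits i (base_of X, b) X k}"
  by (rule idem_image_span_step[OF assms part_spanned[OF assms]])

text \<open>Both sides are linear in \<open>v\<close>, so it suffices to compare them on the basis vectors of the
  space at \<open>X\<close>; these the idempotent fixes or kills, according to their position.\<close>

lemma coord_idem:
  assumes "i \<le> r" and X: "X \<in> verts (quiver i)" and "v \<in> part i X" and "b \<in> B (base_of X)"
  shows "coord (base_of X) (idem (Ms i) X k v) b
    = (if sits i (base_of X, b) X k then coord (base_of X) v b else 0)"
    (is "?f (idem _ _ _ v) = ?g v")
proof -
  let ?x = "base_of X"
  have x: "?x \<in> verts Q" using base_of_verts assms by blast
  note N = mod_idem_level[OF \<open>i \<le> r\<close>]
  note L = mod_idem_linear[OF N X, of k] and V = mod_idem_space[OF N X]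
  note ind = basis(1)[OF x]
  have S: "u \<in> part i X \<Longrightarrow> u \<in> span (B ?x)" for u
    using part_span assms by blast
  have "v \<in> part i X \<and> ?f (idem (Ms i) X k v) = ?g v"
    if "v \<in> span {b \<in> B ?x. b \<in> part i X}" for v
    using that
  proof (rule span_induct)
    show "subspace {v. v \<in> part i X \<and> ?f (idem (Ms i) X k v) = ?g v}"
      using L V linear_between_zero[OF L V] S ind
      by (auto intro!: subspaceI simp: linear_between_def subspace_0 subspace_add subspace_scale
          representation_zero representation_add representation_scale)
  next
    fix c assume c: "c \<in> {b \<in> B ?x. b \<in> part i X}"
    then obtain l where l: "sits i (?x, c) X l" using sits_of_part[OF assms(1,2)] by blast
    have "c \<noteq> 0" using basis_nonzero x c by blast
    have rep: "coord ?x c = (\<lambda>b. if b = c then 1 else 0)"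
      using representation_basis[OF ind] c by blast
    have pos: "sits i (?x, c) X k \<longleftrightarrow> l = k"
      using sits_unique[OF assms(1) \<open>c \<noteq> 0\<close> l, of X k] l by blast
    have "?f (idem (Ms i) X k c) = ?g c"
    proof (cases "b = c")
      case True
      show ?thesis unfolding True sits_idem[OF assms(1) l, of k] pos
        by (simp add: representation_zero)
    next
      case False
      then show ?thesis unfolding sits_idem[OF assms(1) l, of k] by (simp add: rep representation_zero)
    qed
    then show "c \<in> part i X \<and> ?f (idem (Ms i) X k c) = ?g c" using c by blast
  qed
  then show ?thesis using part_spanned[OF assms(1,2)] assms(3) by blast
qed

lemma arcs_Suc:
  "E \<in> arcs (quiver (Suc i)) \<longleftrightarrow>
     (\<exists>A k l. E = Lift_arrow A k l \<and> A \<in> arcs (quiver i) \<and>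
        (\<exists>v\<in>part i (tail (quiver i) A).
           idem (Ms i) (head (quiver i) A) l
             (map_at (Ms i) A (idem (Ms i) (tail (quiver i) A) k v)) \<noteq> 0))"
  by (auto simp: Gamma_quiver_def tower.simps(2))

lemma ends_Suc:
  "tail (quiver (Suc i)) (Lift_arrow A k l) = Lift_vertex (tail (quiver i) A) k"
  "head (quiver (Suc i)) (Lift_arrow A k l) = Lift_vertex (head (quiver i) A) l"
  by (auto simp: Gamma_quiver_def tower.simps(2))

lemma arrow_ends:
  "i \<le> r \<Longrightarrow> A \<in> arcs (quiver i) \<Longrightarrow>
     tail (quiver i) A \<in> verts (quiver i) \<and> head (quiver i) A \<in> verts (quiver i) \<and>
     base_arrow_of A \<in> arcs Q \<and>
     base_of (tail (quiver i) A) = tail Q (base_arrow_of A) \<and>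
     base_of (head (quiver i) A) = head Q (base_arrow_of A)"
proof (induction i arbitrary: A)
  case 0
  then show ?case using arcs_Q by (auto simp: base_quiver_def)
next
  case (Suc i)
  then obtain A' k l v where A: "A = Lift_arrow A' k l" "A' \<in> arcs (quiver i)"
      "v \<in> part i (tail (quiver i) A')"
    and nz: "idem (Ms i) (head (quiver i) A') l
             (map_at (Ms i) A' (idem (Ms i) (tail (quiver i) A') k v)) \<noteq> 0"
    unfolding arcs_Suc by blast
  let ?t = "tail (quiver i) A'" and ?h = "head (quiver i) A'"
  have "i \<le> r" using Suc.prems by simp
  note IH = Suc.IH[OF this A(2)] and N = mod_idem_level[OF this]
  have t: "?t \<in> verts (quiver i)" and h: "?h \<in> verts (quiver i)" using IH by auto
  note lin = mod_idem_arrow_linear[OF N A(2)]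
  have kv: "idem (Ms i) ?t k v \<in> part i ?t" using idem_image_subset[OF N t] A(3) by blast
  then have "map_at (Ms i) A' (idem (Ms i) ?t k v) \<in> part i ?h"
    using lin by (auto simp: linear_between_def)
  then have "l \<in> weights (Ms i) ?h" using nz unfolding weights_def by blast
  moreover have "idem (Ms i) ?t k v \<noteq> 0"
    using nz linear_between_zero[OF lin mod_idem_space[OF N t]]
      linear_between_zero[OF mod_idem_linear[OF N h] mod_idem_space[OF N h]] by auto
  then have "k \<in> weights (Ms i) ?t" using A(3) unfolding weights_def by blast
  ultimately show ?case using IH A(1) by (simp add: verts_Suc ends_Suc)
qed

lemma map_Suc:
  assumes "Suc i \<le> r" and E: "Lift_arrow A k l \<in> arcs (quiver (Suc i))"
    and v: "v \<in> idem (Ms i) (tail (quiver i) A) k ` part i (tail (quiver i) A)"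
  shows "map_at (Ms (Suc i)) (Lift_arrow A k l) v
    = idem (Ms i) (head (quiver i) A) l (map_at (Ms i) A v)"
proof -
  have A: "A \<in> arcs (quiver i)" using E arcs_Suc by blast
  have t: "tail (quiver i) A \<in> verts (quiver i)" using arrow_ends A assms(1) by simp
  have rep: "rep_eq (quiver (Suc i)) (underlying (Ms (Suc i))) (gamma_rep (quiver i) (Ms i))"
    using lifts assms(1) unfolding lift_sequence_def by force
  have "v \<in> part (Suc i) (tail (quiver (Suc i)) (Lift_arrow A k l))"
    using v part_Suc[OF assms(1)] arrow_ends[OF assms(1) E] by (simp add: ends_Suc)
  then have "map_at (Ms (Suc i)) (Lift_arrow A k l) v
      = map_at (gamma_rep (quiver i) (Ms i)) (Lift_arrow A k l) v"
    using rep E unfolding rep_eq_def underlying_def quiver_rep.truncate_def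
    by simp
  also have "\<dots> = idem (Ms i) (head (quiver i) A) l
      (map_at (Ms i) A (idem (Ms i) (tail (quiver i) A) k v))"
    by (simp add: gamma_rep_def)
  also have "idem (Ms i) (tail (quiver i) A) k v = v"
    using idem_fixes_image[OF mod_idem_level t v] assms(1) by simp
  finally show ?thesis .
qed

lemma part_Suc_iff_sits:
  assumes "Suc i \<le> r" and "Lift_vertex Y k \<in> verts (quiver (Suc i))"
    and "b \<in> B (base_of Y)"
  shows "b \<in> part (Suc i) (Lift_vertex Y k) \<longleftrightarrow> sits i (base_of Y, b) Y k"
proof -
  have "Y \<in> verts (quiver i)" using assms(2) by (simp add: verts_Suc)
  moreover have "b \<noteq> 0" using basis_nonzero base_of_verts[of i Y] calculation assms by simp
  ultimately show ?thesis
    using part_Suc[OF assms(1,2)] sitsI[of i Y b k] sitsD(4)[of i "base_of Y" b Y k] assms(1) by auto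
qed

text \<open>The map of an arrow of the tower over \<open>a\<close> is a block of the matrix of \<open>M\<^sub>a\<close>: passing to the
  next level restricts it to the image of one coordinate projection and composes it with
  another.\<close>

lemma coord_arrow:
  assumes "i \<le> r" and "A \<in> arcs (quiver i)" and "v \<in> part i (tail (quiver i) A)"
    and "w \<in> B (head Q (base_arrow_of A))"
  shows "coord (head Q (base_arrow_of A)) (map_at (Ms i) A v) w
    = (if w \<in> part i (head (quiver i) A)
       then coord (head Q (base_arrow_of A)) (map_at M (base_arrow_of A) v) w else 0)"
  using assms
proof (induction i arbitrary: A)
  case 0
  then obtain a where a: "a \<in> arcs Q" "A = Base_arrow a" by (auto simp: base_quiver_def)
  have "w \<in> space_at M (head Q a)"
    using 0 a basis(2)[OF arcs_Q(2)[OF a(1)]] span_base by auto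
  then show ?case using a by (simp add: base_quiver_def Ms_0 idem0_def base_rep_def)
next
  case (Suc i)
  obtain A' k l where A: "A = Lift_arrow A' k l" and A': "A' \<in> arcs (quiver i)"
    using Suc.prems(2) unfolding arcs_Suc by blast
  let ?t = "tail (quiver i) A'" and ?h = "head (quiver i) A'" and ?a = "base_arrow_of A'"
  have "i \<le> r" using Suc.prems by simp
  note N = mod_idem_level[OF this]
  have e: "?t \<in> verts (quiver i)" "?h \<in> verts (quiver i)" "base_of ?h = head Q ?a"
    using arrow_ends[OF \<open>i \<le> r\<close> A'] by auto
  have E: "Lift_vertex ?t k \<in> verts (quiver (Suc i))" "Lift_vertex ?h l \<in> verts (quiver (Suc i))"
    using arrow_ends[OF Suc.prems(1,2)] A by (simp_all add: ends_Suc)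
  have v: "v \<in> idem (Ms i) ?t k ` part i ?t"
    using Suc.prems part_Suc[OF Suc.prems(1) E(1)] A by (simp add: ends_Suc)
  then have vt: "v \<in> part i ?t" using idem_image_subset[OF N e(1)] by blast
  then have mv: "map_at (Ms i) A' v \<in> part i ?h"
    using mod_idem_arrow_linear[OF N A'] by (auto simp: linear_between_def)
  have w: "w \<in> B (base_of ?h)" using Suc.prems(4) A e by simp
  have "coord (head Q ?a) (map_at (Ms (Suc i)) A v) w
      = coord (base_of ?h) (idem (Ms i) ?h l (map_at (Ms i) A' v)) w"
    using map_Suc[OF Suc.prems(1) _ v, of l] Suc.prems(2) A e(3) by simp
  also have "\<dots> = (if sits i (base_of ?h, w) ?h l
      then coord (base_of ?h) (map_at (Ms i) A' v) w else 0)"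
    by (rule coord_idem[OF \<open>i \<le> r\<close> e(2) mv w])
  also have "\<dots> = (if sits i (base_of ?h, w) ?h l
      then coord (base_of ?h) (map_at M ?a v) w else 0)"
    using Suc.IH[OF \<open>i \<le> r\<close> A' vt] w e sits_part[OF \<open>i \<le> r\<close>] by auto
  finally show ?case
    using part_Suc_iff_sits[OF Suc.prems(1) E(2) w] A e by (simp add: ends_Suc)
qed

lemma coord_idem_arrow_idem:
  assumes "i \<le> r" and A: "A \<in> arcs (quiver i)"
    and u: "sits i (tail Q (base_arrow_of A), u) (tail (quiver i) A) k"
    and w: "w \<in> B (head Q (base_arrow_of A))"
  shows "coord (head Q (base_arrow_of A)) (idem (Ms i) (head (quiver i) A) l
      (map_at (Ms i) A (idem (Ms i) (tail (quiver i) A) k u))) w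
    = (if sits i (head Q (base_arrow_of A), w) (head (quiver i) A) l
       then coord (head Q (base_arrow_of A)) (map_at M (base_arrow_of A) u) w else 0)"
proof -
  note e = arrow_ends[OF assms(1) A]
  have uc: "u \<in> part i (tail (quiver i) A)" by (rule sits_part[OF assms(1) u])
  then have mu: "map_at (Ms i) A u \<in> part i (head (quiver i) A)"
    using mod_idem_arrow_linear[OF mod_idem_level[OF assms(1)] A] by (auto simp: linear_between_def)
  have fix_u: "idem (Ms i) (tail (quiver i) A) k u = u"
    using sits_idem[OF assms(1) u, of k] by simp
  have h: "head (quiver i) A \<in> verts (quiver i)"
    and eq: "base_of (head (quiver i) A) = head Q (base_arrow_of A)" using e by auto
  note proj = coord_idem[OF assms(1) h mu, of w l, unfolded eq, OF w]
  show ?thesis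
  proof (cases "sits i (head Q (base_arrow_of A), w) (head (quiver i) A) l")
    case True
    then have "w \<in> part i (head (quiver i) A)" by (rule sits_part[OF assms(1)])
    then show ?thesis
      unfolding fix_u proj using True coord_arrow[OF assms(1) A uc w] by simp
  next
    case False
    then show ?thesis unfolding fix_u proj by simp
  qed
qed

text \<open>If the composite vanished on all basis vectors at index \<open>k\<close>, it would vanish, since these
  span the image of the idempotent of index \<open>k\<close>.  A basis vector on which it does not vanish
  gives a non-zero coordinate, and this is also an entry of the original matrix.\<close>

lemma nonzero_entry:
  assumes "i \<le> r" and A: "A \<in> arcs (quiver i)" and v: "v \<in> part i (tail (quiver i) A)"
    and nz: "idem (Ms i) (head (quiver i) A) l
      (map_at (Ms i) A (idem (Ms i) (tail (quiver i) A) k v)) \<noteq> 0"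
  obtains u w where
    "u \<in> B (tail Q (base_arrow_of A))" "w \<in> B (head Q (base_arrow_of A))"
    "sits i (tail Q (base_arrow_of A), u) (tail (quiver i) A) k"
    "sits i (head Q (base_arrow_of A), w) (head (quiver i) A) l"
    "coord (head Q (base_arrow_of A)) (map_at M (base_arrow_of A) u) w \<noteq> 0"
proof -
  let ?t = "tail (quiver i) A" and ?h = "head (quiver i) A" and ?a = "base_arrow_of A"
  let ?g = "\<lambda>v. idem (Ms i) ?h l (map_at (Ms i) A v)"
  let ?C = "{b \<in> B (base_of ?t). sits i (base_of ?t, b) ?t k}"
  note e = arrow_ends[OF assms(1) A] and N = mod_idem_level[OF assms(1)]
  have t: "?t \<in> verts (quiver i)" and h: "?h \<in> verts (quiver i)" using e by auto
  note V = mod_idem_space[OF N t] and lin = mod_idem_arrow_linear[OF N A]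
  note lin' = mod_idem_linear[OF N h, of l] and V' = mod_idem_space[OF N h]
  have "\<exists>u\<in>?C. ?g u \<noteq> 0"
  proof (rule ccontr)
    assume "\<not> ?thesis"
    then have zero: "?g b = 0" if "b \<in> ?C" for b using that by blast
    have "idem (Ms i) ?t k v \<in> span ?C" using idem_image_spanned[OF assms(1) t] v by blast
    then have "idem (Ms i) ?t k v \<in> part i ?t \<and> ?g (idem (Ms i) ?t k v) = 0"
    proof (rule span_induct)
      show "subspace {v. v \<in> part i ?t \<and> ?g v = 0}"
        using lin lin' V linear_between_zero[OF lin V] linear_between_zero[OF lin' V']
        by (auto intro!: subspaceI simp: linear_between_def subspace_0 subspace_add subspace_scale)
    next
      fix b assume "b \<in> ?C"
      then show "b \<in> part i ?t \<and> ?g b = 0" using zero sits_part[OF assms(1)] by blast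
    qed
    then show False using nz by blast
  qed
  then obtain u where u: "u \<in> ?C" "?g u \<noteq> 0" by blast
  have uat: "sits i (tail Q ?a, u) ?t k" using u e by simp
  have "map_at (Ms i) A u \<in> part i ?h"
    using lin sits_part[OF assms(1) uat] by (auto simp: linear_between_def)
  then have "?g u \<in> part i ?h" using lin' by (auto simp: linear_between_def)
  then have gS: "?g u \<in> span (B (head Q ?a))" using part_span[OF assms(1) h] e by auto
  have ind: "independent (B (head Q ?a))" using basis(1) arcs_Q(2) e by blast
  obtain w where w: "coord (head Q ?a) (?g u) w \<noteq> 0"
    using sum_nonzero_representation_eq[OF ind gS] u(2) by force
  then have wB: "w \<in> B (head Q ?a)" using representation_ne_zero by blast
  have "coord (head Q ?a) (?g u) w
      = (if sits i (head Q ?a, w) ?h l then coord (head Q ?a) (map_at M ?a u) w else 0)"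
    using coord_idem_arrow_idem[OF assms(1) A uat wB, of l] sits_idem[OF assms(1) uat, of k] by simp
  then have "sits i (head Q ?a, w) ?h l" "coord (head Q ?a) (map_at M ?a u) w \<noteq> 0"
    using w by (auto split: if_splits)
  then show thesis using that u wB uat e by auto
qed

text \<open>A non-zero entry survives to every level: refining a block, it lies in the sub-block at the
  indices of its two basis vectors, which is therefore non-zero, and non-zero sub-blocks are the
  arrows of the next level.\<close>

lemma arrow_of_entry:
  assumes a: "a \<in> arcs Q" and u: "u \<in> B (tail Q a)" and w: "w \<in> B (head Q a)"
    and nz: "coord (head Q a) (map_at M a u) w \<noteq> 0" and "i \<le> r"
  shows "\<exists>A\<in>arcs (quiver i). base_arrow_of A = a \<and>
    u \<in> part i (tail (quiver i) A) \<and> w \<in> part i (head (quiver i) A)"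
  using \<open>i \<le> r\<close>
proof (induction i)
  case 0
  have "Base_arrow a \<in> arcs (quiver 0)" using a by (simp add: base_quiver_def)
  moreover have "u \<in> space_at M (tail Q a)" "w \<in> space_at M (head Q a)"
    using u w basis(2) arcs_Q[OF a] span_base by blast+
  ultimately show ?case by (force simp: base_quiver_def Ms_0 idem0_def base_rep_def)
next
  case (Suc i)
  then obtain A where A: "A \<in> arcs (quiver i)" "base_arrow_of A = a"
    "u \<in> part i (tail (quiver i) A)" "w \<in> part i (head (quiver i) A)" by auto
  let ?t = "tail (quiver i) A" and ?h = "head (quiver i) A"
  have "i \<le> r" using Suc.prems by simp
  note e = arrow_ends[OF this A(1)] and N = mod_idem_level[OF this]
  obtain k where k: "sits i (base_of ?t, u) ?t k" using sits_of_part[OF \<open>i \<le> r\<close>, of ?t u] A u e by auto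
  obtain l where l: "sits i (base_of ?h, w) ?h l" using sits_of_part[OF \<open>i \<le> r\<close>, of ?h w] A w e by auto
  let ?E = "Lift_arrow A k l"
  have "coord (head Q a) (idem (Ms i) ?h l (map_at (Ms i) A (idem (Ms i) ?t k u))) w \<noteq> 0"
    using coord_idem_arrow_idem[OF \<open>i \<le> r\<close> A(1), of u k w l] k l A e w nz by simp
  then have "idem (Ms i) ?h l (map_at (Ms i) A (idem (Ms i) ?t k u)) \<noteq> 0"
    by (metis representation_zero)
  then have E: "?E \<in> arcs (quiver (Suc i))" using A by (auto simp: arcs_Suc)
  have "u \<in> part (Suc i) (Lift_vertex ?t k)" "w \<in> part (Suc i) (Lift_vertex ?h l)"
    using arrow_ends[OF Suc.prems E] part_Suc_iff_sits[OF Suc.prems] k l A e u w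
    by (auto simp: ends_Suc)
  then show ?case using E A(2) by (intro bexI[of _ ?E]) (simp_all add: ends_Suc)
qed

text \<open>Each quiver \<open>\<Gamma>(N)\<close> has at most one arrow for an arrow \<open>a\<close> and two indices, so the indices
  collected along the two ends leave no choice.  This is what recovers an arrow of the tower from
  the arguments of \<open>\<Delta>\<close>.\<close>

lemma arrow_unique:
  "A \<in> arcs (quiver i) \<Longrightarrow> A' \<in> arcs (quiver i) \<Longrightarrow> base_arrow_of A = base_arrow_of A' \<Longrightarrow>
   vertex_weights (tail (quiver i) A) = vertex_weights (tail (quiver i) A') \<Longrightarrow>
   vertex_weights (head (quiver i) A) = vertex_weights (head (quiver i) A') \<Longrightarrow> A = A'"
proof (induction i arbitrary: A A')
  case 0
  then show ?case by (auto simp: base_quiver_def)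
next
  case (Suc i)
  obtain C k l where A: "A = Lift_arrow C k l" "C \<in> arcs (quiver i)"
    using Suc.prems(1) unfolding arcs_Suc by blast
  obtain C' k' l' where A': "A' = Lift_arrow C' k' l'" "C' \<in> arcs (quiver i)"
    using Suc.prems(2) unfolding arcs_Suc by blast
  show ?case using Suc.IH[OF A(2) A'(2)] Suc.prems(3-) A A'
    by (simp add: ends_Suc)
qed

section \<open>Shifts and nice gradings\<close>

text \<open>The sign changes between \<open>T\<close> and \<open>\<Delta>\<close>: a shift is the index at the head minus the index at
  the tail, and \<open>\<Delta>\<close> is the opposite difference.\<close>

lemma shift_iff_nice:
  assumes "i \<le> r"
  shows "(\<exists>T. mod_idem_shift scale (quiver i) T (Ms i)) \<longleftrightarrow>
    nice_grading scale Q M B (map (lift_grading Q Ms) [0..<i]) (lift_grading Q Ms i)"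
    (is "?shift \<longleftrightarrow> ?nice")
proof
  assume ?shift
  then obtain T where T: "\<And>A k l v. A \<in> arcs (quiver i) \<Longrightarrow> l - k \<noteq> T A \<Longrightarrow>
      v \<in> part i (tail (quiver i) A) \<Longrightarrow>
      idem (Ms i) (head (quiver i) A) l
        (map_at (Ms i) A (idem (Ms i) (tail (quiver i) A) k v)) = 0"
    unfolding mod_idem_shift_def by blast
  let ?ok = "\<lambda>p q a A. A \<in> arcs (quiver i) \<and> base_arrow_of A = a \<and>
      vertex_weights (tail (quiver i) A) = p \<and> vertex_weights (head (quiver i) A) = q"
  let ?\<Delta> = "\<lambda>p q a. - T (THE A. ?ok p q a A)"
  show ?nice unfolding nice_grading_def
  proof (intro exI[of _ ?\<Delta>] ballI impI)
    fix a u w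
    assume a: "a \<in> arcs Q" and u: "u \<in> B (tail Q a)" and w: "w \<in> B (head Q a)"
      and nz: "coord (head Q a) (map_at M a u) w \<noteq> 0"
    obtain A where A: "A \<in> arcs (quiver i)" "base_arrow_of A = a"
        "u \<in> part i (tail (quiver i) A)" "w \<in> part i (head (quiver i) A)"
      using arrow_of_entry[OF a u w nz assms] by blast
    let ?t = "tail (quiver i) A" and ?h = "head (quiver i) A"
    note e = arrow_ends[OF assms A(1)]
    have u0: "u \<noteq> 0" and w0: "w \<noteq> 0" using basis_nonzero arcs_Q[OF a] u w by blast+
    obtain k where k: "sits i (tail Q a, u) ?t k" using sits_of_part[OF assms, of ?t u] A u e by auto
    obtain l where l: "sits i (head Q a, w) ?h l" using sits_of_part[OF assms, of ?h w] A w e by auto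
    let ?p = "map (\<lambda>f. f (tail Q a, u)) (map (lift_grading Q Ms) [0..<i])"
    let ?q = "map (\<lambda>f. f (head Q a, w)) (map (lift_grading Q Ms) [0..<i])"
    \<comment> \<open>The lists of gradings identify \<open>A\<close>, so the definite description in \<open>\<Delta>\<close> denotes it.\<close>
    have ok: "?ok ?p ?q a A"
      using A vertex_weights_sits[OF assms u0 k] vertex_weights_sits[OF assms w0 l] by simp
    have "(THE A. ?ok ?p ?q a A) = A"
      using ok arrow_unique[of _ i A] by (intro the_equality) auto
    moreover have "l - k = T A"
    proof (rule ccontr)
      assume "l - k \<noteq> T A"
      then have "idem (Ms i) ?h l (map_at (Ms i) A (idem (Ms i) ?t k u)) = 0"
        using T A by blast
      then show False
        using coord_idem_arrow_idem[OF assms A(1), of u k w l] k l A(2) w nz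
        by (simp add: representation_zero)
    qed
    ultimately show "?\<Delta> ?p ?q a = lift_grading Q Ms i (tail Q a, u) - lift_grading Q Ms i (head Q a, w)"
      using lift_grading_sits[OF assms u0 k] lift_grading_sits[OF assms w0 l] by simp
  qed
next
  assume ?nice
  then obtain \<Delta> where \<Delta>: "\<And>a u w. a \<in> arcs Q \<Longrightarrow> u \<in> B (tail Q a) \<Longrightarrow> w \<in> B (head Q a) \<Longrightarrow>
      coord (head Q a) (map_at M a u) w \<noteq> 0 \<Longrightarrow>
      \<Delta> (map (\<lambda>f. f (tail Q a, u)) (map (lift_grading Q Ms) [0..<i]))
        (map (\<lambda>f. f (head Q a, w)) (map (lift_grading Q Ms) [0..<i])) a
        = lift_grading Q Ms i (tail Q a, u) - lift_grading Q Ms i (head Q a, w)"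
    unfolding nice_grading_def by blast
  let ?T = "\<lambda>A. - \<Delta> (vertex_weights (tail (quiver i) A)) (vertex_weights (head (quiver i) A))
    (base_arrow_of A)"
  have "idem (Ms i) (head (quiver i) A) l
      (map_at (Ms i) A (idem (Ms i) (tail (quiver i) A) k v)) = 0"
    if A: "A \<in> arcs (quiver i)" and T: "l - k \<noteq> ?T A"
      and v: "v \<in> part i (tail (quiver i) A)" for A k l v
  proof (rule ccontr)
    let ?a = "base_arrow_of A"
    assume "\<not> ?thesis"
    then obtain u w where uw: "u \<in> B (tail Q ?a)" "w \<in> B (head Q ?a)"
        "sits i (tail Q ?a, u) (tail (quiver i) A) k" "sits i (head Q ?a, w) (head (quiver i) A) l"
        "coord (head Q ?a) (map_at M ?a u) w \<noteq> 0"
      using nonzero_entry[OF assms A v] by blast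
    have a: "?a \<in> arcs Q" using arrow_ends[OF assms A] by blast
    have u0: "u \<noteq> 0" and w0: "w \<noteq> 0" using basis_nonzero arcs_Q[OF a] uw by blast+
    show False
      using \<Delta>[OF a uw(1,2,5)] T vertex_weights_sits[OF assms u0 uw(3)]
        vertex_weights_sits[OF assms w0 uw(4)]
        lift_grading_sits[OF assms u0 uw(3)] lift_grading_sits[OF assms w0 uw(4)]
      by simp
  qed
  then have "mod_idem_shift scale (quiver i) ?T (Ms i)"
    using mod_idem_level[OF assms] unfolding mod_idem_shift_def by blast
  then show ?shift by blast
qed

text \<open>Equivariance constrains the levels \<open>1, \<dots>, r\<close>, whereas niceness starts at \<open>0\<close>.  All of \<open>M\<^sup>0\<close>
  has index \<open>0\<close>, so the level \<open>0\<close> adds no condition.\<close>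

lemma shift_level_0: "mod_idem_shift scale (quiver 0) (\<lambda>_. 0) (Ms 0)"
  unfolding mod_idem_shift_def
proof (intro conjI mod_idem_0 ballI allI impI)
  fix A l k v
  assume A: "A \<in> arcs (quiver 0)" and "l - k \<noteq> (0::int)"
  then have lk: "l \<noteq> 0 \<or> k \<noteq> 0" by auto
  have "tail (quiver 0) A \<in> verts (quiver 0)" using arrow_ends[OF le0 A] by blast
  then have "map_at (Ms 0) A 0 = 0"
    by (rule linear_between_zero[OF mod_idem_arrow_linear[OF mod_idem_0 A]
          mod_idem_space[OF mod_idem_0]])
  then show "idem (Ms 0) (head (quiver 0) A) l
      (map_at (Ms 0) A (idem (Ms 0) (tail (quiver 0) A) k v)) = 0"
    unfolding idem_0 using lk by simp
qed

lemma equivariant_iff_nice: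
  "equivariant_lifts scale Q r Ms \<longleftrightarrow>
    (\<forall>i\<le>r. nice_grading scale Q M B (map (lift_grading Q Ms) [0..<i]) (lift_grading Q Ms i))"
proof -
  have "equivariant_lifts scale Q r Ms \<longleftrightarrow>
      (\<forall>i\<le>r. \<exists>T. mod_idem_shift scale (quiver i) T (Ms i))"
    unfolding equivariant_lifts_def
  proof (intro iffI allI impI ballI)
    fix i assume eq: "\<forall>j\<in>{1..r}. \<exists>T. mod_idem_shift scale (quiver j) T (Ms j)" and "i \<le> r"
    show "\<exists>T. mod_idem_shift scale (quiver i) T (Ms i)"
    proof (cases "i = 0")
      case True
      then show ?thesis using shift_level_0 by blast
    next
      case False
      then have "i \<in> {1..r}" using \<open>i \<le> r\<close> by simp
      then show ?thesis using eq by blast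
    qed
  qed simp
  then show ?thesis using shift_iff_nice by blast
qed

end

theorem proposition6p6:
  fixes scale :: "complex \<Rightarrow> 'w::ab_group_add \<Rightarrow> 'w"
    and Q :: "('v, 'a) pre_digraph"
    and M :: "('v, 'a, 'w) quiver_rep"
    and r :: nat
    and Ms :: "nat \<Rightarrow> ('v vertex, 'a arrow, 'w) idem_rep"
    and B :: "'v \<Rightarrow> 'w set"
  assumes "vector_space scale"
    and "fin_digraph Q"
    and "is_quiver_rep scale Q M"
    and "r \<ge> 1"
    and "lift_sequence scale Q M r Ms"
    and "adapted_basis scale Q M r Ms B"
  shows "equivariant_lifts scale Q r Ms \<longleftrightarrow>
    (\<forall>i\<le>r. nice_grading scale Q M B (map (lift_grading Q Ms) [0..<i]) (lift_grading Q Ms i))"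
proof -
  have "wf_digraph Q" using assms(2) by (rule fin_digraph.axioms(1))
  then interpret adapted_lifts scale Q M r Ms B
    using assms unfolding adapted_lifts_def adapted_lifts_axioms_def
      complex_vector_space_def by blast
  show ?thesis by (rule equivariant_iff_nice)
qed

end
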